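(* There exist absolute constants $c, C>0$ with the following property. For every $m_0$ there exist an integer $m\ge m_0$, a set $\mathcal{A}$ of $m$ positive integers, and a graph $G_m$ with vertex set $\mathcal{A}$ and at least $c\, m^{5/3}/\log^{1/3} m$ edges such that $$|\mathcal{A}+_{G_m}\mathcal{A}|+|\mathcal{A}\cdot_{G_m}\mathcal{A}|\le C\,(|\mathcal{A}|\log|\mathcal{A}|)^{4/3}.$$
   Context: For a finite set $\mathcal{A}$ of numbers and a graph $G$ whose vertices are the elements of $\mathcal{A}$, the sumset along $G$ is $\mathcal{A}+_{G}\mathcal{A}=\{a+b : \{a,b\}\in E(G)\}$ and the product set along $G$ is $\mathcal{A}\cdot_{G}\mathcal{A}=\{ab : \{a,b\}\in E(G)\}$. *)

theory Defs
  imports Complex_Main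
begin

definition simple_graph :: "'a set \<Rightarrow> 'a set set \<Rightarrow> bool" where
  "simple_graph V E \<longleftrightarrow> finite V \<and> E \<subseteq> {{a, b} | a b. a \<in> V \<and> b \<in> V \<and> a \<noteq> b}"

definition sumset_along :: "'a::ab_semigroup_add set set \<Rightarrow> 'a set" where
  "sumset_along E = {a + b | a b. {a, b} \<in> E}"

definition prodset_along :: "'a::ab_semigroup_mult set set \<Rightarrow> 'a set" where
  "prodset_along E = {a * b | a b. {a, b} \<in> E}"

end

theory Submission
  imports Defs
begin

text \<open>
  Fix \<open>N\<close>, put \<open>L = N\<^sup>2 + 1\<close>, and join \<open>(1 + L k) w / v\<close> to \<open>(1 + L k') v / w\<close> for \<open>k, k' < N\<^sup>4\<close> and
  coprime \<open>w < v \<le> N\<close>; multiplying by \<open>N!\<close> makes everything an integer. There are at most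
  \<open>N\<^sup>6\<close> vertices, and isolated ones may be added to have exactly \<open>N\<^sup>6\<close>. A product depends only on
  \<open>(k, k')\<close>, a sum only on \<open>w\<close>, \<open>v\<close> and \<open>k w\<^sup>2 + k' v\<^sup>2 \<le> 2 N\<^sup>6\<close>, so both number \<open>O(N\<^sup>8)\<close>.
  Reducing modulo \<open>L\<close> shows that an edge determines \<open>w / v\<close>, \<open>k\<close> and \<open>k'\<close>; as a positive proportion
  of the pairs \<open>(w, v)\<close> is coprime, there are at least a constant times \<open>N^10\<close> edges.
\<close>

section \<open>Counting coprime pairs\<close>

definition triangle_pairs :: "nat \<Rightarrow> (nat \<times> nat) set" where
  "triangle_pairs N = {(w, v). 0 < w \<and> w < v \<and> v \<le> N}"

definition coprime_pairs :: "nat \<Rightarrow> (nat \<times> nat) set" where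
  "coprime_pairs N = {(w, v) \<in> triangle_pairs N. coprime w v}"

lemma triangle_pairs_subset: "triangle_pairs N \<subseteq> {1..N} \<times> {1..N}"
  by (auto simp: triangle_pairs_def)

lemma finite_triangle_pairs [simp]: "finite (triangle_pairs N)"
  by (rule finite_subset[OF triangle_pairs_subset]) simp

lemma finite_coprime_pairs [simp]: "finite (coprime_pairs N)"
  by (rule finite_subset[OF _ finite_triangle_pairs[of N]]) (auto simp: coprime_pairs_def)

lemma card_triangle_pairs: "2 * real (card (triangle_pairs N)) = real N * (real N - 1)"
proof (induction N)
  case 0
  have "triangle_pairs 0 = {}" by (auto simp: triangle_pairs_def)
  then show ?case by simp
next
  case (Suc N)
  have "triangle_pairs (Suc N) = triangle_pairs N \<union> {1..N} \<times> {Suc N}"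
    by (auto simp: triangle_pairs_def)
  moreover have "triangle_pairs N \<inter> {1..N} \<times> {Suc N} = {}"
    by (auto simp: triangle_pairs_def)
  ultimately have "card (triangle_pairs (Suc N)) = card (triangle_pairs N) + N"
    by (simp add: card_Un_disjoint card_cartesian_product)
  with Suc show ?case by (simp add: algebra_simps)
qed

text \<open>Dividing both coordinates by \<open>d\<close> embeds these pairs into
  \<open>triangle_pairs (N div d)\<close>, whose size is at most half of
  \<open>(N div d)^2\<close>.\<close>

lemma card_triangle_pairs_dvd:
  assumes "d > 0"
  shows "2 * real (card {(w, v) \<in> triangle_pairs N. d dvd w \<and> d dvd v}) \<le> real N ^ 2 / real d ^ 2"
proof -
  have "{(w, v) \<in> triangle_pairs N. d dvd w \<and> d dvd v}
      \<subseteq> (\<lambda>(x, y). (d * x, d * y)) ` triangle_pairs (N div d)"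
  proof clarify
    fix w v assume wv: "(w, v) \<in> triangle_pairs N" "d dvd w" "d dvd v"
    then obtain x y where xy: "w = d * x" "v = d * y" by (elim dvdE)
    have "y \<le> N div d"
      using wv(1) assms unfolding xy
      by (simp add: triangle_pairs_def less_eq_div_iff_mult_less_eq mult.commute)
    then have "(x, y) \<in> triangle_pairs (N div d)"
      using wv(1) unfolding xy by (auto simp: triangle_pairs_def)
    then show "(w, v) \<in> (\<lambda>(x, y). (d * x, d * y)) ` triangle_pairs (N div d)"
      unfolding xy by force
  qed
  then have "card {(w, v) \<in> triangle_pairs N. d dvd w \<and> d dvd v} \<le> card (triangle_pairs (N div d))"
    by (rule surj_card_le[OF finite_triangle_pairs])
  then have "2 * real (card {(w, v) \<in> triangle_pairs N. d dvd w \<and> d dvd v})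
      \<le> real (N div d) * (real (N div d) - 1)"
    using card_triangle_pairs[of "N div d"] by linarith
  also have "\<dots> \<le> real (N div d) ^ 2" by (simp add: power2_eq_square algebra_simps)
  also have "\<dots> \<le> (real N / real d) ^ 2"
    by (intro power_mono) (auto simp: of_nat_div_le_of_nat)
  finally show ?thesis by (simp add: power_divide)
qed

text \<open>Telescoping with 1/(n+1)^2 <= 1/n - 1/(n+1); the term \<open>1 / real n\<close> carries
  the induction, and 3/4 = 1/4 + 1/2 makes the case n = 2 an equality. What matters later is that
  3/4 is below 1.\<close>

lemma sum_inverse_squares_from_2:
  assumes "n \<ge> 2"
  shows "(\<Sum>d = 2..n. 1 / real d ^ 2) \<le> 3/4 - 1 / real n"
  using assms
proof (induction n rule: dec_induct)
  case base
  show ?case by simp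
next
  case (step n)
  have "1 / real (Suc n) ^ 2 \<le> 1 / real n - 1 / real (Suc n)"
    using step.hyps by (simp add: divide_simps power2_eq_square)
  moreover have "(\<Sum>d = 2..Suc n. 1 / real d ^ 2) = (\<Sum>d = 2..n. 1 / real d ^ 2) + 1 / real (Suc n) ^ 2"
    using step.hyps by simp
  ultimately show ?case using step.IH by linarith
qed

text \<open>Union bound: a pair that is not coprime lies in \<open>B d\<close> for its gcd d, which
  is between 2 and N. These sets cover at most 3/4 of N^2/2 pairs.\<close>

lemma card_coprime_pairs_ge:
  assumes "N \<ge> 8"
  shows "16 * real (card (coprime_pairs N)) \<ge> real N ^ 2"
proof -
  define B where "B d = {(w, v) \<in> triangle_pairs N. d dvd w \<and> d dvd v}" for d
  have finB: "finite (B d)" for d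
    by (rule finite_subset[OF _ finite_triangle_pairs[of N]]) (auto simp: B_def)
  have "triangle_pairs N \<subseteq> coprime_pairs N \<union> (\<Union>d\<in>{2..N}. B d)"
  proof clarify
    fix w v assume wv: "(w, v) \<in> triangle_pairs N" "(w, v) \<notin> (\<Union>d\<in>{2..N}. B d)"
    have "gcd w v \<le> w" "gcd w v > 0" "w \<le> N"
      using wv(1) by (auto simp: triangle_pairs_def intro!: gcd_le1_nat)
    moreover have "gcd w v \<notin> {2..N}"
      using wv by (auto simp: B_def)
    ultimately have "gcd w v = 1" by (simp only: atLeastAtMost_iff) linarith
    then show "(w, v) \<in> coprime_pairs N"
      using wv(1) by (auto simp: coprime_pairs_def coprime_iff_gcd_eq_1)
  qed
  then have "card (triangle_pairs N) \<le> card (coprime_pairs N \<union> (\<Union>d\<in>{2..N}. B d))"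
    by (intro card_mono) (auto simp: finB)
  also have "\<dots> \<le> card (coprime_pairs N) + card (\<Union>d\<in>{2..N}. B d)"
    by (rule card_Un_le)
  also have "\<dots> \<le> card (coprime_pairs N) + (\<Sum>d = 2..N. card (B d))"
    by (intro add_left_mono card_UN_le) simp
  finally have "2 * real (card (triangle_pairs N))
      \<le> 2 * real (card (coprime_pairs N)) + (\<Sum>d = 2..N. 2 * real (card (B d)))"
    by (simp add: sum_distrib_left[symmetric] of_nat_sum[symmetric] del: of_nat_sum)
  also have "(\<Sum>d = 2..N. 2 * real (card (B d))) \<le> (\<Sum>d = 2..N. real N ^ 2 * (1 / real d ^ 2))"
    unfolding B_def by (intro sum_mono order_trans[OF card_triangle_pairs_dvd]) auto
  also have "\<dots> = real N ^ 2 * (\<Sum>d = 2..N. 1 / real d ^ 2)"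
    by (rule sum_distrib_left[symmetric])
  also have "\<dots> \<le> real N ^ 2 * (3/4)"
    using assms by (intro mult_left_mono order_trans[OF sum_inverse_squares_from_2]) auto
  finally have "real N * (real N - 1) \<le> 2 * real (card (coprime_pairs N)) + real N ^ 2 * (3/4)"
    unfolding card_triangle_pairs by simp
  \<comment> \<open>The bound so far is 2 * card >= N^2/4 - N, and N <= N^2/8 leaves N^2/8, whence
    the factor 16.\<close>
  moreover have "real N ^ 2 \<ge> 8 * real N"
    using assms by (simp add: power2_eq_square)
  ultimately show ?thesis by (simp add: power2_eq_square algebra_simps)
qed

section \<open>The graph\<close>

text \<open>The integer \<open>N! (1 + (N\<^sup>2 + 1) k) p / q\<close>, for \<open>0 < q \<le> N\<close>.\<close>

definition vtx :: "nat \<Rightarrow> nat \<Rightarrow> nat \<Rightarrow> nat \<Rightarrow> nat" where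
  "vtx N k p q = (1 + (N^2 + 1) * k) * p * (fact N div q)"

definition graph_edge :: "nat \<Rightarrow> (nat \<times> nat) \<times> nat \<times> nat \<Rightarrow> int set" where
  "graph_edge N = (\<lambda>((k, k'), w, v). {int (vtx N k w v), int (vtx N k' v w)})"

definition graph_edges :: "nat \<Rightarrow> int set set" where
  "graph_edges N = graph_edge N ` (({..<N^4} \<times> {..<N^4}) \<times> coprime_pairs N)"

section \<open>Cleared denominators and injectivity of the edge parametrization\<close>

lemma vtx_mult:
  assumes "q \<in> {1..N}"
  shows "vtx N k p q * q = (1 + (N^2 + 1) * k) * p * fact N"
proof -
  have "fact N div q * q = fact N"
    using assms by (intro dvd_div_mult_self dvd_fact) auto
  then show ?thesis by (simp add: vtx_def mult.assoc)
qed

lemma vtx_pos: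
  assumes "p \<in> {1..N}" "q \<in> {1..N}"
  shows "vtx N k p q > 0"
proof -
  have "vtx N k p q * q > 0" unfolding vtx_mult[OF assms(2)] using assms by simp
  then show ?thesis by simp
qed

text \<open>Modulo \<open>L\<close> the factors 1 + L k and 1 + L k' are both 1, and
  \<open>p\<close>, \<open>q\<close> are their own residues because they are below \<open>L\<close>.
  Cancelling p = q > 0 then gives k = k'.\<close>

lemma progression_mult_eq:
  fixes L :: nat
  assumes "(1 + L * k) * p = (1 + L * k') * q" "0 < p" "p < L" "q < L"
  shows "p = q" "k = k'"
proof -
  have "(p + L * (k * p)) mod L = (q + L * (k' * q)) mod L"
    using assms(1) by (simp add: algebra_simps)
  then show "p = q" using assms by simp
  then show "k = k'" using assms by simp
qed

lemma vtx_eq: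
  assumes eq: "vtx N k p q = vtx N k' p' q'"
    and "p \<in> {1..N}" "q \<in> {1..N}" "p' \<in> {1..N}" "q' \<in> {1..N}"
  shows "p * q' = p' * q" "k = k'"
proof -
  have "(vtx N k p q * q) * q' = (vtx N k' p' q' * q') * q"
    using eq by simp
  then have "((1 + (N^2 + 1) * k) * (p * q')) * fact N = ((1 + (N^2 + 1) * k') * (p' * q)) * fact N"
    unfolding vtx_mult[OF assms(3)] vtx_mult[OF assms(5)] by (simp only: mult.assoc mult.left_commute mult.commute)
  then have *: "(1 + (N^2 + 1) * k) * (p * q') = (1 + (N^2 + 1) * k') * (p' * q)"
    by (simp only: mult_cancel2 fact_nonzero) simp
  \<comment> \<open>This explains the modulus N^2 + 1: it just exceeds every cross product of
    numbers up to N.\<close>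
  have "p * q' \<le> N * N" "p' * q \<le> N * N"
    using assms by (intro mult_mono; simp)+
  then have "p * q' < N^2 + 1" "p' * q < N^2 + 1" "0 < p * q'"
    using assms by (auto simp: power2_eq_square)
  from progression_mult_eq[OF * this(3,1,2)] show "p * q' = p' * q" "k = k'" by auto
qed

text \<open>The first endpoint of an edge has ratio w/v < 1 and the second v'/w' > 1, so the two
  roles never share a vertex. This rules out loops and lets an unordered edge remember its
  orientation.\<close>

lemma vtx_neq_swapped:
  assumes "(w, v) \<in> triangle_pairs N" "(w', v') \<in> triangle_pairs N"
  shows "vtx N k w v \<noteq> vtx N k' v' w'"
proof
  assume "vtx N k w v = vtx N k' v' w'"
  then have "w * w' = v' * v"
    using assms by (intro vtx_eq(1)) (auto simp: triangle_pairs_def)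
  moreover have "w * w' < v * v'"
    using assms by (intro mult_strict_mono) (auto simp: triangle_pairs_def)
  ultimately show False by (simp add: mult.commute)
qed

lemma inj_on_graph_edge:
  "inj_on (graph_edge N) (({..<N^4} \<times> {..<N^4}) \<times> coprime_pairs N)"
proof (rule inj_onI)
  fix e f
  assume ef: "e \<in> ({..<N^4} \<times> {..<N^4}) \<times> coprime_pairs N"
    "f \<in> ({..<N^4} \<times> {..<N^4}) \<times> coprime_pairs N" "graph_edge N e = graph_edge N f"
  obtain k k' w v l l' x y where e: "e = ((k, k'), w, v)" and f: "f = ((l, l'), x, y)"
    by (metis surj_pair)
  have wv: "(w, v) \<in> coprime_pairs N" and xy: "(x, y) \<in> coprime_pairs N"
    and eq: "graph_edge N ((k, k'), w, v) = graph_edge N ((l, l'), x, y)"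
    using ef unfolding e f by auto
  have tri: "(w, v) \<in> triangle_pairs N" "(x, y) \<in> triangle_pairs N"
    and cop: "coprime w v" "coprime x y"
    using wv xy by (auto simp: coprime_pairs_def)
  have "vtx N k w v = vtx N l x y \<and> vtx N k' v w = vtx N l' y x"
    using eq vtx_neq_swapped[OF tri] by (auto simp: graph_edge_def doubleton_eq_iff)
  moreover have mem: "w \<in> {1..N}" "v \<in> {1..N}" "x \<in> {1..N}" "y \<in> {1..N}"
    using tri by (auto simp: triangle_pairs_def)
  ultimately have "w * y = x * v" "k = l" "k' = l'"
    using vtx_eq[of N k w v l x y] vtx_eq(2)[of N k' v w l' y x] by auto
  \<comment> \<open>w/v = x/y with both fractions in lowest terms; here the restriction to coprime
    pairs is used.\<close>
  moreover from this have "w = x \<and> v = y"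
    using coprime_crossproduct_nat[of w v x y] cop by (simp add: mult.commute)
  ultimately show "e = f"
    unfolding e f by simp
qed

lemma card_graph_edges_ge:
  assumes "N \<ge> 8"
  shows "16 * real (card (graph_edges N)) \<ge> real N ^ 10"
proof -
  have "card (graph_edges N) = N^8 * card (coprime_pairs N)"
    unfolding graph_edges_def
    by (subst card_image[OF inj_on_graph_edge]) (simp add: card_cartesian_product power_add[symmetric])
  then have "16 * real (card (graph_edges N)) = real N ^ 8 * (16 * real (card (coprime_pairs N)))"
    by simp
  also have "\<dots> \<ge> real N ^ 8 * real N ^ 2"
    by (intro mult_left_mono card_coprime_pairs_ge assms) simp
  finally show ?thesis by (simp add: power_add[symmetric])
qed

section \<open>Bounds on the product set and the sumset\<close>

lemma graph_edges_doubletonE: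
  assumes "{a, b} \<in> graph_edges N"
  obtains k k' w v where "k < N^4" "k' < N^4" "(w, v) \<in> triangle_pairs N"
    "a + b = int (vtx N k w v + vtx N k' v w)" "a * b = int (vtx N k w v * vtx N k' v w)"
proof -
  from assms obtain k k' w v where *: "k < N^4" "k' < N^4" "(w, v) \<in> triangle_pairs N"
    and eq: "{a, b} = {int (vtx N k w v), int (vtx N k' v w)}"
    by (auto simp: graph_edges_def graph_edge_def coprime_pairs_def)
  \<comment> \<open>Sum and product are symmetric, so it does not matter which of \<open>a\<close>,
    \<open>b\<close> is which endpoint.\<close>
  from eq have "a + b = int (vtx N k w v + vtx N k' v w)" "a * b = int (vtx N k w v * vtx N k' v w)"
    by (auto simp: doubleton_eq_iff)
  with * show thesis by (rule that)
qed

text \<open>The reciprocal ratios w/v and v/w cancel, so only N^4 * N^4 products can occur.\<close>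

lemma vtx_prod:
  assumes "w \<in> {1..N}" "v \<in> {1..N}"
  shows "vtx N k w v * vtx N k' v w = (1 + (N^2 + 1) * k) * (1 + (N^2 + 1) * k') * fact N ^ 2"
proof -
  have "(vtx N k w v * vtx N k' v w) * (v * w) = (vtx N k w v * v) * (vtx N k' v w * w)"
    by (simp only: mult.assoc mult.left_commute mult.commute)
  also have "\<dots> = ((1 + (N^2 + 1) * k) * (1 + (N^2 + 1) * k') * fact N ^ 2) * (v * w)"
    unfolding vtx_mult[OF assms(1)] vtx_mult[OF assms(2)] power2_eq_square[of "fact N"]
    by (simp only: mult.assoc mult.left_commute mult.commute)
  finally show ?thesis using assms by (simp only: mult_cancel2) auto
qed

text \<open>Over the common denominator v w, the parameters \<open>k\<close>, \<open>k'\<close>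
  enter only through k w^2 + k' v^2. This collapses the N^8 choices of (k, k') to O(N^6) values for
  each (w, v).\<close>

lemma vtx_sum:
  assumes "w \<in> {1..N}" "v \<in> {1..N}"
  shows "vtx N k w v + vtx N k' v w
    = (w^2 + v^2 + (N^2 + 1) * (k * w^2 + k' * v^2)) * fact N div (v * w)"
proof -
  have "(vtx N k w v + vtx N k' v w) * (v * w) = (vtx N k w v * v) * w + (vtx N k' v w * w) * v"
    by (simp add: algebra_simps)
  also have "\<dots> = (w^2 + v^2 + (N^2 + 1) * (k * w^2 + k' * v^2)) * fact N"
    unfolding vtx_mult[OF assms(1)] vtx_mult[OF assms(2)]
    by (simp add: algebra_simps power2_eq_square)
  finally show ?thesis using assms
    by (metis atLeastAtMost_iff mult_is_0 nonzero_mult_div_cancel_right not_one_le_zero)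
qed

lemma card_prodset_graph_edges: "card (prodset_along (graph_edges N)) \<le> N^8"
proof -
  define f where "f = (\<lambda>(k, k'). int ((1 + (N^2 + 1) * k) * (1 + (N^2 + 1) * k') * fact N ^ 2))"
  have "prodset_along (graph_edges N) \<subseteq> f ` ({..<N^4} \<times> {..<N^4})"
  proof
    fix s assume "s \<in> prodset_along (graph_edges N)"
    then obtain a b where s: "s = a * b" and "{a, b} \<in> graph_edges N"
      by (auto simp: prodset_along_def)
    from this(2) obtain k k' w v where k: "k < N^4" "k' < N^4" "(w, v) \<in> triangle_pairs N"
      and "a * b = int (vtx N k w v * vtx N k' v w)"
      by (rule graph_edges_doubletonE)
    then have "s = f (k, k')"
      using vtx_prod[of w N v k k'] by (simp only: s f_def) (auto simp: triangle_pairs_def)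
    then show "s \<in> f ` ({..<N^4} \<times> {..<N^4})" using k by blast
  qed
  then have "card (prodset_along (graph_edges N)) \<le> card ({..<N^4} \<times> {..<N^4})"
    by (intro surj_card_le) auto
  then show ?thesis by (simp add: card_cartesian_product power_add[symmetric])
qed

lemma card_sumset_graph_edges: "card (sumset_along (graph_edges N)) \<le> 3 * N^8"
proof -
  define f where
    "f = (\<lambda>((w, v), r). int ((w^2 + v^2 + (N^2 + 1) * r) * fact N div (v * w)))"
  let ?D = "({1..N} \<times> {1..N}) \<times> {..2 * N^6}"
  have "sumset_along (graph_edges N) \<subseteq> f ` ?D"
  proof
    fix s assume "s \<in> sumset_along (graph_edges N)"
    then obtain a b where s: "s = a + b" and "{a, b} \<in> graph_edges N"
      by (auto simp: sumset_along_def)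
    from this(2) obtain k k' w v where k: "k < N^4" "k' < N^4" and tri: "(w, v) \<in> triangle_pairs N"
      and ab: "a + b = int (vtx N k w v + vtx N k' v w)"
      by (rule graph_edges_doubletonE)
    have mem: "w \<in> {1..N}" "v \<in> {1..N}" using tri by (auto simp: triangle_pairs_def)
    have "k * w^2 \<le> N^4 * N^2" "k' * v^2 \<le> N^4 * N^2"
      using k mem by (intro mult_mono power_mono; simp)+
    then have "k * w^2 + k' * v^2 \<le> 2 * N^6"
      by (simp add: power_add[symmetric])
    moreover have "s = f ((w, v), k * w^2 + k' * v^2)"
      unfolding s ab vtx_sum[OF mem] f_def by simp
    ultimately show "s \<in> f ` ?D" using mem by blast
  qed
  then have "card (sumset_along (graph_edges N)) \<le> card ?D"
    by (intro surj_card_le) auto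
  also have "\<dots> = N^2 * (2 * N^6 + 1)"
    by (simp add: card_cartesian_product power2_eq_square)
  also have "\<dots> = 2 * N^8 + N^2"
    by (simp add: algebra_simps power_add[symmetric])
  \<comment> \<open>The stray N^2 comes from the closed range \<open>{..2 * N^6}\<close>, which has
    one element more than 2 N^6.\<close>
  also have "N^2 \<le> N^8"
    by (cases "N = 0") (auto intro: power_increasing)
  finally show ?thesis by simp
qed

section \<open>The vertex set and the final choice of parameters\<close>

lemma exists_vertex_set:
  "\<exists>A. finite A \<and> card A = N^6 \<and> (\<forall>a\<in>A. a > 0) \<and> simple_graph A (graph_edges N)"
proof -
  let ?D = "{..<N^4} \<times> {1..N} \<times> {1..N}"
  define A0 where "A0 = (\<lambda>(k, p, q). int (vtx N k p q)) ` ?D"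
  have "card A0 \<le> card ?D" unfolding A0_def by (rule card_image_le) simp
  also have "\<dots> = N^4 * N^2" by (simp add: card_cartesian_product power2_eq_square)
  also have "\<dots> = N^6" by (simp add: power_add[symmetric])
  finally have card_A0: "card A0 \<le> N^6" .
  have fin: "finite A0" and pos: "\<forall>a\<in>A0. a > 0"
    by (auto simp: A0_def intro!: vtx_pos)
  \<comment> \<open>Different (p, q) with equal ratio give the same vertex, so \<open>A0\<close> may
    be smaller than N^6. Fresh positive integers are added as isolated vertices to reach N^6
    exactly.\<close>
  have "infinite ({0<..} - A0)"
    using fin by (simp add: infinite_Ioi)
  then obtain B where B: "finite B" "card B = N^6 - card A0" "B \<subseteq> {0<..} - A0"
    using infinite_arbitrarily_large by blast
  have "card (A0 \<union> B) = N^6"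
    using fin B card_A0 by (subst card_Un_disjoint) auto
  moreover have "simple_graph (A0 \<union> B) (graph_edges N)"
  proof -
    have "e \<in> {{a, b} | a b. a \<in> A0 \<union> B \<and> b \<in> A0 \<union> B \<and> a \<noteq> b}" if e: "e \<in> graph_edges N" for e
    proof -
      from e obtain k k' w v where e: "e = {int (vtx N k w v), int (vtx N k' v w)}"
        and k: "k < N^4" "k' < N^4" and tri: "(w, v) \<in> triangle_pairs N"
        by (auto simp: graph_edges_def graph_edge_def coprime_pairs_def)
      have "(k, w, v) \<in> ?D" "(k', v, w) \<in> ?D"
        using k tri by (auto simp: triangle_pairs_def)
      then have "int (vtx N k w v) \<in> A0" "int (vtx N k' v w) \<in> A0"
        unfolding A0_def by force+
      moreover have "int (vtx N k w v) \<noteq> int (vtx N k' v w)"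
        using vtx_neq_swapped[OF tri tri] by simp
      ultimately show ?thesis using e by blast
    qed
    then show ?thesis using fin B(1) by (auto simp: simple_graph_def)
  qed
  ultimately show ?thesis
    using fin pos B by (intro exI[of _ "A0 \<union> B"]) auto
qed

theorem theorem2p1:
  shows "\<exists>c C :: real. c > 0 \<and> C > 0 \<and>
    (\<forall>m0 :: nat. \<exists>m \<ge> m0. \<exists>(A :: int set) (E :: int set set).
       finite A \<and> card A = m \<and> (\<forall>a\<in>A. a > 0) \<and> simple_graph A E \<and>
       real (card E) \<ge> c * real m powr (5/3) / (ln (real m)) powr (1/3) \<and>
       real (card (sumset_along E)) + real (card (prodset_along E))
         \<le> C * (real (card A) * ln (real (card A))) powr (4/3))"
proof (rule exI[of _ "1/16"], rule exI[of _ 4], intro conjI allI)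
  fix m0 :: nat
  \<comment> \<open>With m = N^6, N >= 8 serves the count of coprime pairs, and N >= m0 gives m >=
    m0.\<close>
  define N where "N = max 8 m0"
  have N: "N \<ge> 8" "N \<ge> m0" by (auto simp: N_def)
  from exists_vertex_set[of N] obtain A where A: "finite A" "card A = N^6" "\<forall>a\<in>A. a > 0"
    "simple_graph A (graph_edges N)" by auto
  have m0: "N^6 \<ge> m0"
    using N self_le_power[of N 6] by simp
  have "real (N^6) = real N powr 6"
    using N powr_realpow[of "real N" 6] by simp
  \<comment> \<open>These are the orders of the edge count and of the two sets; the constants are
    1/16 from the coprime pairs and 4 = 3 + 1 from sumset and product set.\<close>
  then have powr: "real (N^6) powr (5/3) = real N ^ 10" "real (N^6) powr (4/3) = real N ^ 8"
    using N by (simp_all only: powr_powr) simp_all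
  \<comment> \<open>Once ln m >= 1, dividing by its power only lowers the edge bound and multiplying
    by it only raises the upper bound, so the estimates without logarithms suffice.\<close>
  have "exp 1 \<le> real N"
    using exp_le N by linarith
  also have "\<dots> \<le> real (N^6)"
    using N self_le_power[of "real N" 6] by simp
  finally have ln: "ln (real (N^6)) \<ge> 1"
    using N by (subst ln_ge_iff) auto
  have "ln (real (N^6)) powr (1/3) \<ge> 1"
    using ln by (rule ge_one_powr_ge_zero) simp
  then have "1/16 * real (N^6) powr (5/3) / ln (real (N^6)) powr (1/3) \<le> 1/16 * real (N^6) powr (5/3) / 1"
    by (intro divide_left_mono) (auto simp del: of_nat_power)
  also have "\<dots> \<le> real (card (graph_edges N))"
    using card_graph_edges_ge[OF N(1)] unfolding powr by simp
  finally have edges: "1/16 * real (N^6) powr (5/3) / ln (real (N^6)) powr (1/3)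
      \<le> real (card (graph_edges N))" .
  have "real (card (sumset_along (graph_edges N))) + real (card (prodset_along (graph_edges N)))
      \<le> real (3 * N^8) + real (N^8)"
    by (intro add_mono of_nat_mono card_sumset_graph_edges card_prodset_graph_edges)
  also have "\<dots> = 4 * real (N^6) powr (4/3)"
    unfolding powr by simp
  also have "\<dots> \<le> 4 * (real (N^6) * ln (real (N^6))) powr (4/3)"
    using mult_left_mono[OF ln, of "real (N^6)"] by (intro mult_left_mono powr_mono2) simp_all
  finally show "\<exists>m \<ge> m0. \<exists>(A :: int set) (E :: int set set).
       finite A \<and> card A = m \<and> (\<forall>a\<in>A. a > 0) \<and> simple_graph A E \<and>
       real (card E) \<ge> 1/16 * real m powr (5/3) / (ln (real m)) powr (1/3) \<and>
       real (card (sumset_along E)) + real (card (prodset_along E))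
         \<le> 4 * (real (card A) * ln (real (card A))) powr (4/3)"
    using A m0 edges
    by (intro exI[of _ "N^6"] conjI exI[of _ A] exI[of _ "graph_edges N"]) auto
qed auto

end
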